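(* Let $M$ be a binary matrix that is a $(2,* )$-matrix or a $( *,2)$-matrix and that has no two identical rows and no two identical columns. Suppose $M$ does not have the simultaneous consecutive ones property and contains none of the matrices $M_{2_1},M_{2_2},M_{3_1},M_{3_2},M_{3_3},M_{2_1}^T,M_{2_2}^T,M_{3_1}^T,M_{3_2}^T,M_{3_3}^T$. Then any two submatrices of $M$ that are isomorphic to some $M_{I_k}$ or $M_{I_k}^T$ ($k\ge1$) are pairwise disjoint, i.e. they share no row and no column of $M$.
   Context: A binary matrix has the consecutive ones property (C1P) for rows if its columns can be permuted so that in every row the $1$-entries occur consecutively; it has the C1P for columns if its rows can be permuted so that in every column the $1$-entries occur consecutively; it has the simultaneous consecutive ones property (SC1P) if it has both. A $(2,* )$-matrix has at most two ones in each column; a $( *,2)$-matrix has at most two ones in each row. Two matrices are isomorphic if one is obtained from the other by permuting rows and/or columns; $M$ contains $N$ if some submatrix of $M$ (obtained by selecting a subset of rows and a subset of columns) is isomorphic to $N$. For $k\ge1$, $M_{I_k}$ is the $(k+2)\times(k+2)$ binary matrix in which, for $1\le i\le k+1$, row $i$ has ones exactly in columns $i$ and $i+1$, and row $k+2$ has ones exactly in columns $1$ and $k+2$. The matrices (given row by row) are: $M_{2_1}$: $1100,\ 0110,\ 0111,\ 1101$; $M_{2_2}$: $11000,\ 01100,\ 00110,\ 01111,\ 11101$; $M_{3_1}$: $1100,\ 0110,\ 0101$; $M_{3_2}$: $11000,\ 01100,\ 00110,\ 01101$; $M_{3_3}$: $110000,\ 011000,\ 001100,\ 000110,\ 011101$.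 $N^T$ denotes the transpose. *)

theory Defs
  imports "Jordan_Normal_Form.DL_Submatrix" "HOL-Combinatorics.Permutations"
begin

definition binary_mat :: "nat mat \<Rightarrow> bool" where
  "binary_mat A \<longleftrightarrow> elements_mat A \<subseteq> {0, 1}"

definition permute_mat :: "(nat \<Rightarrow> nat) \<Rightarrow> (nat \<Rightarrow> nat) \<Rightarrow> 'a mat \<Rightarrow> 'a mat" where
  "permute_mat p q A = mat (dim_row A) (dim_col A) (\<lambda>(i, j). A $$ (p i, q j))"

definition isomorphic_mat :: "'a mat \<Rightarrow> 'a mat \<Rightarrow> bool" where
  "isomorphic_mat A B \<longleftrightarrow>
     (\<exists>p q. p permutes {..<dim_row A} \<and> q permutes {..<dim_col A} \<and> B = permute_mat p q A)"

definition contains_mat :: "'a mat \<Rightarrow> 'a mat \<Rightarrow> bool" where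
  "contains_mat M N \<longleftrightarrow>
     (\<exists>I J. I \<subseteq> {..<dim_row M} \<and> J \<subseteq> {..<dim_col M} \<and> isomorphic_mat (submatrix M I J) N)"

definition consecutive_ones_in_rows :: "nat mat \<Rightarrow> bool" where
  "consecutive_ones_in_rows A \<longleftrightarrow>
     (\<forall>i < dim_row A. \<forall>j1 j2 j3. j1 < j2 \<longrightarrow> j2 < j3 \<longrightarrow> j3 < dim_col A \<longrightarrow>
        A $$ (i, j1) = 1 \<longrightarrow> A $$ (i, j3) = 1 \<longrightarrow> A $$ (i, j2) = 1)"

definition consecutive_ones_in_cols :: "nat mat \<Rightarrow> bool" where
  "consecutive_ones_in_cols A \<longleftrightarrow>
     (\<forall>j < dim_col A. \<forall>i1 i2 i3. i1 < i2 \<longrightarrow> i2 < i3 \<longrightarrow> i3 < dim_row A \<longrightarrow>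
        A $$ (i1, j) = 1 \<longrightarrow> A $$ (i3, j) = 1 \<longrightarrow> A $$ (i2, j) = 1)"

definition C1P_rows :: "nat mat \<Rightarrow> bool" where
  "C1P_rows M \<longleftrightarrow>
     (\<exists>q. q permutes {..<dim_col M} \<and> consecutive_ones_in_rows (permute_mat id q M))"

definition C1P_cols :: "nat mat \<Rightarrow> bool" where
  "C1P_cols M \<longleftrightarrow>
     (\<exists>p. p permutes {..<dim_row M} \<and> consecutive_ones_in_cols (permute_mat p id M))"

definition SC1P :: "nat mat \<Rightarrow> bool" where
  "SC1P M \<longleftrightarrow> C1P_rows M \<and> C1P_cols M"

text \<open>A \<open>(2,*)\<close>-matrix bounds the ones in each column, a \<open>(*,2)\<close>-matrix those in each row.\<close>

definition two_star_mat :: "nat mat \<Rightarrow> bool" where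
  "two_star_mat M \<longleftrightarrow> (\<forall>j < dim_col M. card {i. i < dim_row M \<and> M $$ (i, j) = 1} \<le> 2)"

definition star_two_mat :: "nat mat \<Rightarrow> bool" where
  "star_two_mat M \<longleftrightarrow> (\<forall>i < dim_row M. card {j. j < dim_col M \<and> M $$ (i, j) = 1} \<le> 2)"

text \<open>Indices are shifted to start at \<open>0\<close>; the last row is row \<open>k + 1\<close>.\<close>

definition M_I :: "nat \<Rightarrow> nat mat" where
  "M_I k = mat (k + 2) (k + 2) (\<lambda>(i, j).
     if i < k + 1 then (if j = i \<or> j = i + 1 then 1 else 0)
     else (if j = 0 \<or> j = k + 1 then 1 else 0))"

definition M_2_1 :: "nat mat" where
  "M_2_1 = mat_of_rows_list 4
     [[1,1,0,0],
      [0,1,1,0],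
      [0,1,1,1],
      [1,1,0,1]]"

definition M_2_2 :: "nat mat" where
  "M_2_2 = mat_of_rows_list 5
     [[1,1,0,0,0],
      [0,1,1,0,0],
      [0,0,1,1,0],
      [0,1,1,1,1],
      [1,1,1,0,1]]"

definition M_3_1 :: "nat mat" where
  "M_3_1 = mat_of_rows_list 4
     [[1,1,0,0],
      [0,1,1,0],
      [0,1,0,1]]"

definition M_3_2 :: "nat mat" where
  "M_3_2 = mat_of_rows_list 5
     [[1,1,0,0,0],
      [0,1,1,0,0],
      [0,0,1,1,0],
      [0,1,1,0,1]]"

definition M_3_3 :: "nat mat" where
  "M_3_3 = mat_of_rows_list 6
     [[1,1,0,0,0,0],
      [0,1,1,0,0,0],
      [0,0,1,1,0,0],
      [0,0,0,1,1,0],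
      [0,1,1,1,0,1]]"

text \<open>A submatrix is identified by its position, i.e. by its sets of row and column indices.\<close>

definition M_I_position :: "nat mat \<Rightarrow> nat set \<Rightarrow> nat set \<Rightarrow> bool" where
  "M_I_position M I J \<longleftrightarrow> I \<subseteq> {..<dim_row M} \<and> J \<subseteq> {..<dim_col M} \<and>
     (\<exists>k \<ge> 1. isomorphic_mat (submatrix M I J) (M_I k) \<or>
              isomorphic_mat (submatrix M I J) (transpose_mat (M_I k)))"

end

theory Submission
  imports Defs
begin

text \<open>
  Let every column contain at most two ones, so that the columns with two ones are the edges of a
  simple graph on the rows, and the positions of the matrices \<open>M_I k\<close> are its cycles. If two
  distinct cycles meet, they share a vertex (row), and by connectivity some shared vertex is left by
  the two cycles through different edges. This vertex has at least three edges, and since the graph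
  is simple these have three distinct further endpoints: the resulting claw is the transpose
  of \<open>M_3_1\<close>. The other case is the transpose.
\<close>

section \<open>Isomorphic submatrices as labellings of rows and columns\<close>

lemma bij_betw_pick:
  assumes "finite S"
  shows "bij_betw (pick S) {..<card S} S"
proof -
  have inj: "inj_on (pick S) {..<card S}"
    by (rule linorder_inj_onI') (use pick_mono_le in fastforce)
  moreover have "pick S ` {..<card S} \<subseteq> S"
    using pick_in_set_le by auto
  ultimately show ?thesis
    using card_subset_eq[OF assms] by (simp add: bij_betw_def card_image)
qed

text \<open>Two labellings of the same set differ by the relabelling
  \<open>inv_into A f \<circ> g\<close>, continued by the identity outside \<open>A\<close> as
  \<open>permutes\<close> demands. With \<open>f\<close> the increasing labelling
  \<open>pick\<close>, this turns any labelling into a permutation.\<close>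

lemma bij_betw_factor_permutes:
  assumes f: "bij_betw f A B" and g: "bij_betw g A B"
  obtains p where "p permutes A" and "\<And>x. x \<in> A \<Longrightarrow> f (p x) = g x"
proof
  let ?p = "\<lambda>x. if x \<in> A then inv_into A f (g x) else x"
  have "bij_betw (inv_into A f \<circ> g) A A"
    using bij_betw_trans[OF g bij_betw_inv_into[OF f]] .
  then have "bij_betw ?p A A"
    by (rule bij_betw_cong[THEN iffD1, rotated]) simp
  then show "?p permutes A"
    by (rule bij_imp_permutes) simp
  show "f (?p x) = g x" if "x \<in> A" for x
    using that f g by (simp add: bij_betw_inv_into_right bij_betwE)
qed

text \<open>\<open>submatrix\<close> lists the chosen indices in increasing order through
  \<open>pick\<close>, and permuting that order yields every other labelling of the same index sets.
  From here on, \<open>pick\<close> and permutations are replaced by free bijections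
  \<open>r\<close> and \<open>c\<close>.\<close>

lemma isomorphic_submatrix_iff:
  assumes I: "I \<subseteq> {..<dim_row M}" and J: "J \<subseteq> {..<dim_col M}"
  shows "isomorphic_mat (submatrix M I J) N \<longleftrightarrow>
    (\<exists>r c. bij_betw r {..<dim_row N} I \<and> bij_betw c {..<dim_col N} J \<and>
       (\<forall>i < dim_row N. \<forall>j < dim_col N. N $$ (i, j) = M $$ (r i, c j)))"
    (is "?iso \<longleftrightarrow> ?emb")
proof -
  have fin: "finite I" "finite J"
    using I J finite_subset by blast+
  have sets: "{i. i < dim_row M \<and> i \<in> I} = I" "{j. j < dim_col M \<and> j \<in> J} = J"
    using I J by auto
  have dims: "dim_row (submatrix M I J) = card I" "dim_col (submatrix M I J) = card J"
    by (simp_all add: dim_submatrix sets)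
  have idx: "submatrix M I J $$ (i, j) = M $$ (pick I i, pick J j)" if "i < card I" "j < card J" for i j
    using submatrix_index[of i M I j J] that by (simp add: sets)
  show ?thesis
  proof
    assume ?iso
    then obtain p q where p: "p permutes {..<card I}" and q: "q permutes {..<card J}"
      and N: "N = permute_mat p q (submatrix M I J)"
      unfolding isomorphic_mat_def dims by auto
    have dN: "dim_row N = card I" "dim_col N = card J"
      by (simp_all add: N permute_mat_def dims)
    have "bij_betw (pick I \<circ> p) {..<dim_row N} I" "bij_betw (pick J \<circ> q) {..<dim_col N} J"
      unfolding dN using p q bij_betw_pick fin by (auto intro: bij_betw_trans permutes_imp_bij)
    moreover have "N $$ (i, j) = M $$ ((pick I \<circ> p) i, (pick J \<circ> q) j)"
      if "i < dim_row N" "j < dim_col N" for i j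
      using that permutes_in_image[OF p, of i] permutes_in_image[OF q, of j]
      unfolding dN by (simp add: N permute_mat_def dims idx)
    ultimately show ?emb by blast
  next
    assume ?emb
    then obtain r c where r: "bij_betw r {..<dim_row N} I" and c: "bij_betw c {..<dim_col N} J"
      and N: "\<And>i j. i < dim_row N \<Longrightarrow> j < dim_col N \<Longrightarrow> N $$ (i, j) = M $$ (r i, c j)"
      by blast
    have dN: "dim_row N = card I" "dim_col N = card J"
      using bij_betw_same_card[OF r] bij_betw_same_card[OF c] by simp_all
    obtain p where p: "p permutes {..<card I}" "\<And>i. i \<in> {..<card I} \<Longrightarrow> pick I (p i) = r i"
      using bij_betw_factor_permutes[OF bij_betw_pick[OF fin(1)] r[unfolded dN]] by blast
    obtain q where q: "q permutes {..<card J}" "\<And>j. j \<in> {..<card J} \<Longrightarrow> pick J (q j) = c j"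
      using bij_betw_factor_permutes[OF bij_betw_pick[OF fin(2)] c[unfolded dN]] by blast
    have "N = permute_mat p q (submatrix M I J)"
    proof (rule eq_matI)
      fix i j
      assume "i < dim_row (permute_mat p q (submatrix M I J))"
        "j < dim_col (permute_mat p q (submatrix M I J))"
      then have ij: "i < card I" "j < card J"
        by (simp_all add: permute_mat_def dims)
      then show "N $$ (i, j) = permute_mat p q (submatrix M I J) $$ (i, j)"
        using permutes_in_image[OF p(1), of i] permutes_in_image[OF q(1), of j] p(2) q(2)
        by (simp add: permute_mat_def dims idx N dN)
    qed (simp_all add: permute_mat_def dims dN)
    then show ?iso
      unfolding isomorphic_mat_def dims using p(1) q(1) by blast
  qed
qed

section \<open>Transposing containments and positions\<close>

lemma isomorphic_submatrix_transpose:
  assumes I: "I \<subseteq> {..<dim_row M}" and J: "J \<subseteq> {..<dim_col M}"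
    and iso: "isomorphic_mat (submatrix M I J) N"
  shows "isomorphic_mat (submatrix (transpose_mat M) J I) (transpose_mat N)"
proof -
  obtain r c where r: "bij_betw r {..<dim_row N} I" and c: "bij_betw c {..<dim_col N} J"
    and N: "\<forall>i < dim_row N. \<forall>j < dim_col N. N $$ (i, j) = M $$ (r i, c j)"
    using iso unfolding isomorphic_submatrix_iff[OF I J] by blast
  have "transpose_mat N $$ (j, i) = transpose_mat M $$ (c j, r i)"
    if "j < dim_col N" "i < dim_row N" for i j
  proof -
    have "r i \<in> I" "c j \<in> J"
      using that r c by (auto dest: bij_betwE)
    then have "r i < dim_row M" "c j < dim_col M"
      using I J by auto
    with that N show ?thesis by simp
  qed
  then show ?thesis
    using I J r c by (subst isomorphic_submatrix_iff) auto
qed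

lemma contains_mat_transpose:
  assumes "contains_mat M N"
  shows "contains_mat (transpose_mat M) (transpose_mat N)"
proof -
  obtain I J where IJ: "I \<subseteq> {..<dim_row M}" "J \<subseteq> {..<dim_col M}"
    and "isomorphic_mat (submatrix M I J) N"
    using assms by (auto simp: contains_mat_def)
  then have "isomorphic_mat (submatrix (transpose_mat M) J I) (transpose_mat N)"
    by (simp add: isomorphic_submatrix_transpose)
  with IJ show ?thesis
    by (auto simp: contains_mat_def)
qed

lemma M_I_position_transpose:
  assumes "M_I_position M I J"
  shows "M_I_position (transpose_mat M) J I"
proof -
  have IJ: "I \<subseteq> {..<dim_row M}" "J \<subseteq> {..<dim_col M}"
    using assms by (auto simp: M_I_position_def)
  then show ?thesis
    \<comment> \<open>Transposition exchanges the two alternatives of the definition; the second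
      instance covers a transposed \<open>M_I k\<close>, whose double transpose is
      \<open>M_I k\<close> again.\<close>
    using assms isomorphic_submatrix_transpose[OF IJ]
      isomorphic_submatrix_transpose[OF IJ, of "transpose_mat N" for N]
    unfolding M_I_position_def by fastforce
qed

section \<open>Positions of \<open>M_I k\<close> as cycles: degrees and connectivity\<close>

lemma M_I_positionE:
  assumes "M_I_position M I J"
  obtains k r c where "bij_betw r {..<k + 2} I" and "bij_betw c {..<k + 2} J"
    and "(\<forall>i < k + 2. \<forall>j < k + 2. M $$ (r i, c j) = M_I k $$ (i, j)) \<or>
         (\<forall>i < k + 2. \<forall>j < k + 2. M $$ (r i, c j) = M_I k $$ (j, i))"
proof -
  have I: "I \<subseteq> {..<dim_row M}" and J: "J \<subseteq> {..<dim_col M}"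
    using assms by (auto simp: M_I_position_def)
  have dim: "dim_row (M_I k) = k + 2" "dim_col (M_I k) = k + 2" for k
    by (simp_all add: M_I_def)
  obtain k where "isomorphic_mat (submatrix M I J) (M_I k) \<or>
      isomorphic_mat (submatrix M I J) (transpose_mat (M_I k))"
    using assms by (auto simp: M_I_position_def)
  then show thesis
  proof
    assume "isomorphic_mat (submatrix M I J) (M_I k)"
    then obtain r c where "bij_betw r {..<k + 2} I" "bij_betw c {..<k + 2} J"
      "\<forall>i < k + 2. \<forall>j < k + 2. M_I k $$ (i, j) = M $$ (r i, c j)"
      unfolding isomorphic_submatrix_iff[OF I J] dim by blast
    then show thesis
      by (intro that) auto
  next
    assume "isomorphic_mat (submatrix M I J) (transpose_mat (M_I k))"
    then obtain r c where "bij_betw r {..<k + 2} I" "bij_betw c {..<k + 2} J"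
      "\<forall>i < k + 2. \<forall>j < k + 2. transpose_mat (M_I k) $$ (i, j) = M $$ (r i, c j)"
      unfolding isomorphic_submatrix_iff[OF I J] index_transpose_mat dim by blast
    then show thesis
      by (intro that) (auto simp: dim)
  qed
qed

lemma card_M_I_row:
  assumes "i < k + 2"
  shows "card {j. j < k + 2 \<and> M_I k $$ (i, j) = 1} = 2"
proof -
  have "{j. j < k + 2 \<and> M_I k $$ (i, j) = 1} = (if i < k + 1 then {i, i + 1} else {0, k + 1})"
    using assms by (auto simp: M_I_def split: if_splits)
  then show ?thesis by simp
qed

text \<open>\<open>M_I k\<close> is the incidence matrix of a cycle of length \<open>k + 2\<close>,
  so columns carry two ones just as rows do. Column \<open>0\<close> closes the cycle through rows
  \<open>0\<close> and \<open>k + 1\<close>; any other column meets two consecutive rows.\<close>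

lemma card_M_I_col:
  assumes "j < k + 2"
  shows "card {i. i < k + 2 \<and> M_I k $$ (i, j) = 1} = 2"
proof (cases j)
  case 0
  then have "{i. i < k + 2 \<and> M_I k $$ (i, j) = 1} = {0, k + 1}"
    by (auto simp: M_I_def split: if_splits)
  then show ?thesis by simp
next
  case (Suc m)
  then have "{i. i < k + 2 \<and> M_I k $$ (i, j) = 1} = {m, Suc m}"
    using assms by (auto simp: M_I_def split: if_splits)
  then show ?thesis by simp
qed

text \<open>A row of the position is a row or a column of \<open>M_I k\<close>, according to the
  alternative, and both have two ones; the count is carried over along \<open>c\<close>.\<close>

lemma M_I_position_card_row:
  assumes pos: "M_I_position M I J" and "i \<in> I"
  shows "card {j \<in> J. M $$ (i, j) = 1} = 2"
proof -
  obtain k r c where r: "bij_betw r {..<k + 2} I" and c: "bij_betw c {..<k + 2} J"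
    and ent: "(\<forall>i < k + 2. \<forall>j < k + 2. M $$ (r i, c j) = M_I k $$ (i, j)) \<or>
         (\<forall>i < k + 2. \<forall>j < k + 2. M $$ (r i, c j) = M_I k $$ (j, i))"
    using M_I_positionE[OF pos] .
  obtain a where a: "a < k + 2" "i = r a"
    using r \<open>i \<in> I\<close> by (auto simp: bij_betw_def)
  have "{j \<in> J. M $$ (i, j) = 1} = c ` {j. j < k + 2 \<and> M $$ (i, c j) = 1}"
    using c by (auto simp: bij_betw_def)
  moreover have "inj_on c {j. j < k + 2 \<and> M $$ (i, c j) = 1}"
    using c by (auto simp: bij_betw_def inj_on_def)
  ultimately have "card {j \<in> J. M $$ (i, j) = 1} = card {j. j < k + 2 \<and> M $$ (i, c j) = 1}"
    by (simp add: card_image)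
  also have "\<dots> = 2"
    using ent
  proof
    assume "\<forall>i < k + 2. \<forall>j < k + 2. M $$ (r i, c j) = M_I k $$ (i, j)"
    then have "{j. j < k + 2 \<and> M $$ (i, c j) = 1} = {j. j < k + 2 \<and> M_I k $$ (a, j) = 1}"
      using a by auto
    then show ?thesis using card_M_I_row[OF a(1)] by simp
  next
    assume "\<forall>i < k + 2. \<forall>j < k + 2. M $$ (r i, c j) = M_I k $$ (j, i)"
    then have "{j. j < k + 2 \<and> M $$ (i, c j) = 1} = {j. j < k + 2 \<and> M_I k $$ (j, a) = 1}"
      using a by auto
    then show ?thesis using card_M_I_col[OF a(1)] by simp
  qed
  finally show ?thesis .
qed

lemma M_I_position_card_col:
  assumes pos: "M_I_position M I J" and "j \<in> J"
  shows "card {i \<in> I. M $$ (i, j) = 1} = 2"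
proof -
  have "I \<subseteq> {..<dim_row M}" "j < dim_col M"
    using assms by (auto simp: M_I_position_def)
  then have "{i \<in> I. M $$ (i, j) = 1} = {i \<in> I. transpose_mat M $$ (j, i) = 1}"
    by auto
  then show ?thesis
    using M_I_position_card_row[OF M_I_position_transpose[OF pos] \<open>j \<in> J\<close>] by simp
qed

text \<open>A cycle is connected: consecutive rows \<open>r i\<close> and \<open>r (Suc i)\<close>
  share a column, so a nonempty set of rows that is closed under sharing a column contains them
  all.\<close>

lemma M_I_position_connected:
  assumes pos: "M_I_position M I J" and "S \<subseteq> I" and "S \<noteq> {}"
    and closed: "\<And>i i' j. i \<in> S \<Longrightarrow> i' \<in> I \<Longrightarrow> j \<in> J \<Longrightarrow>
      M $$ (i, j) = 1 \<Longrightarrow> M $$ (i', j) = 1 \<Longrightarrow> i' \<in> S"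
  shows "S = I"
proof -
  obtain k r c where r: "bij_betw r {..<k + 2} I" and c: "bij_betw c {..<k + 2} J"
    and ent: "(\<forall>i < k + 2. \<forall>j < k + 2. M $$ (r i, c j) = M_I k $$ (i, j)) \<or>
         (\<forall>i < k + 2. \<forall>j < k + 2. M $$ (r i, c j) = M_I k $$ (j, i))"
    using M_I_positionE[OF pos] .
  have rI: "r i \<in> I" and cJ: "c i \<in> J" if "i < k + 2" for i
    using r c that by (auto dest: bij_betwE)
  have step: "r i \<in> S \<longleftrightarrow> r (Suc i) \<in> S" if "i < k + 1" for i
  proof -
    \<comment> \<open>Rows \<open>i\<close> and \<open>i + 1\<close> of \<open>M_I k\<close> meet in
      column \<open>i + 1\<close>; for \<open>i = k\<close> the second of these ones is the last
      entry of the closing row. In the transposed case, columns \<open>i\<close> and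
      \<open>i + 1\<close> of \<open>M_I k\<close> meet in row \<open>i\<close>.\<close>
    have "\<exists>j < k + 2. M $$ (r i, c j) = 1 \<and> M $$ (r (Suc i), c j) = 1"
      using ent
    proof
      assume "\<forall>i < k + 2. \<forall>j < k + 2. M $$ (r i, c j) = M_I k $$ (i, j)"
      then show ?thesis
        using that by (intro exI[of _ "Suc i"]) (auto simp: M_I_def)
    next
      assume "\<forall>i < k + 2. \<forall>j < k + 2. M $$ (r i, c j) = M_I k $$ (j, i)"
      then show ?thesis
        using that by (intro exI[of _ i]) (auto simp: M_I_def)
    qed
    then show ?thesis
      using closed rI[of i] rI[of "Suc i"] cJ that by (metis Suc_eq_plus1 add_2_eq_Suc' less_SucI not_less_eq)
  qed
  have all: "r i \<in> S \<longleftrightarrow> r 0 \<in> S" if "i < k + 2" for i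
    using that by (induction i) (auto simp: step[symmetric])
  have "I = r ` {..<k + 2}"
    using r by (simp add: bij_betw_def)
  then show ?thesis
    using all \<open>S \<subseteq> I\<close> \<open>S \<noteq> {}\<close> by auto
qed

section \<open>Absence of parallel edges, and claws\<close>

lemma binary_mat_entry:
  "binary_mat M \<Longrightarrow> i < dim_row M \<Longrightarrow> j < dim_col M \<Longrightarrow> M $$ (i, j) = 0 \<or> M $$ (i, j) = 1"
  unfolding binary_mat_def
  using elements_matI[of M "dim_row M" "dim_col M" i j "M $$ (i, j)"] by auto

text \<open>A 0/1 column is determined by where its ones are, so distinct columns mean that no two
  edges have the same ends.\<close>

lemma binary_mat_cols_eqI:
  assumes "binary_mat M" and "distinct (cols M)" and "j < dim_col M" and "j' < dim_col M"
    and ones: "{i. i < dim_row M \<and> M $$ (i, j) = 1} = {i. i < dim_row M \<and> M $$ (i, j') = 1}"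
  shows "j = j'"
proof -
  have "col M j = col M j'"
  proof (rule eq_vecI)
    fix i assume "i < dim_vec (col M j')"
    then have "i < dim_row M" by simp
    moreover from this have "M $$ (i, j) = 1 \<longleftrightarrow> M $$ (i, j') = 1"
      using ones by blast
    ultimately show "col M j $ i = col M j' $ i"
      using binary_mat_entry[OF assms(1), of i j] binary_mat_entry[OF assms(1), of i j'] assms(3,4)
      by auto
  qed simp
  then have "cols M ! j = cols M ! j'"
    using assms(3,4) by simp
  then show ?thesis
    using assms(2-4) nth_eq_iff_index_eq[of "cols M" j j'] by simp
qed

lemma three_edges_contains_claw:
  assumes bin: "binary_mat M" and dist: "distinct (cols M)" and v: "v < dim_row M"
    and D: "D \<subseteq> {..<dim_col M}" "3 \<le> card D"
    and inc: "\<And>j. j \<in> D \<Longrightarrow> M $$ (v, j) = 1"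
    and two: "\<And>j. j \<in> D \<Longrightarrow> card {i. i < dim_row M \<and> M $$ (i, j) = 1} = 2"
  shows "contains_mat M (transpose_mat M_3_1)"
proof -
  have "\<exists>w. w \<noteq> v \<and> {i. i < dim_row M \<and> M $$ (i, j) = 1} = {v, w}" if j: "j \<in> D" for j
  proof -
    obtain a b where "{i. i < dim_row M \<and> M $$ (i, j) = 1} = {a, b}" "a \<noteq> b"
      using two[OF j] by (auto simp: card_2_iff)
    moreover from this have "v \<in> {a, b}"
      using inc[OF j] v by blast
    ultimately show ?thesis
      by (metis empty_iff insert_commute insert_iff)
  qed
  then obtain w where w: "\<And>j. j \<in> D \<Longrightarrow> w j \<noteq> v"
    "\<And>j. j \<in> D \<Longrightarrow> {i. i < dim_row M \<and> M $$ (i, j) = 1} = {v, w j}"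
    by metis
  \<comment> \<open>Edges at \<open>v\<close> with the same other end \<open>w j\<close> would be
    parallel.\<close>
  have inj: "w j = w j' \<longleftrightarrow> j = j'" if "j \<in> D" "j' \<in> D" for j j'
    using binary_mat_cols_eqI[OF bin dist, of j j'] w(2)[OF that(1)] w(2)[OF that(2)] that D(1)
    by (metis lessThan_iff subsetD)
  have wdim: "w j < dim_row M" if "j \<in> D" for j
    using w(2)[OF that] by blast
  have ent: "M $$ (i, j) = (if i = v \<or> i = w j then 1 else 0)" if "j \<in> D" "i < dim_row M" for i j
    using w(2)[OF that(1)] binary_mat_entry[OF bin that(2), of j] that D(1)
    by (auto simp: set_eq_iff)
  obtain T where T: "T \<subseteq> D" "card T = 3"
    using obtain_subset_with_card_n[OF D(2)] by metis
  then obtain x y z where xyz: "x \<in> D" "y \<in> D" "z \<in> D" "x \<noteq> y" "y \<noteq> z" "x \<noteq> z"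
    by (auto simp: card_3_iff)
  \<comment> \<open>The centre \<open>v\<close> stands second because the column of
    \<open>M_3_1\<close> with three ones has index \<open>1\<close>; the leaf \<open>w x\<close>
    comes first because the first row of \<open>M_3_1\<close> has its other one at index
    \<open>0\<close>.\<close>
  let ?r = "(!) [w x, v, w y, w z]" and ?c = "(!) [x, y, z]"
  have neq: "w x \<noteq> v" "w y \<noteq> v" "w z \<noteq> v" "w x \<noteq> w y" "w y \<noteq> w z" "w x \<noteq> w z"
    using xyz w(1) by (simp_all add: inj)
  have bij: "bij_betw ?r {..<4} {w x, v, w y, w z}" "bij_betw ?c {..<3} {x, y, z}"
    by (rule bij_betw_nth; use xyz neq neq[symmetric] in simp)+
  have dim: "dim_row M_3_1 = 3" "dim_col M_3_1 = 4"
    by (simp_all add: M_3_1_def mat_of_rows_list_def)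
  have "transpose_mat M_3_1 $$ (i, j) = M $$ (?r i, ?c j)" if "i < 4" "j < 3" for i j
  proof -
    have "i \<in> {0, 1, 2, 3}" "j \<in> {0, 1, 2}" using that by auto
    then show ?thesis
      using xyz v neq neq[symmetric]
      by (auto simp: M_3_1_def mat_of_rows_list_def ent wdim)
  qed
  moreover have sub: "{w x, v, w y, w z} \<subseteq> {..<dim_row M}" "{x, y, z} \<subseteq> {..<dim_col M}"
    using xyz D(1) v wdim by auto
  ultimately have "isomorphic_mat (submatrix M {w x, v, w y, w z} {x, y, z}) (transpose_mat M_3_1)"
    unfolding isomorphic_submatrix_iff[OF sub] index_transpose_mat dim using bij by blast
  with sub show ?thesis
    unfolding contains_mat_def by blast
qed

section \<open>Two cycles that meet coincide\<close>

lemma M_I_positions_disjoint_two_star: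
  assumes bin: "binary_mat M" and two: "two_star_mat M" and dist: "distinct (cols M)"
    and claw: "\<not> contains_mat M (transpose_mat M_3_1)"
    and pos: "M_I_position M I J" and pos': "M_I_position M I' J'"
    and ne: "(I, J) \<noteq> (I', J')"
  shows "I \<inter> I' = {} \<and> J \<inter> J' = {}"
proof -
  have sub: "I \<subseteq> {..<dim_row M}" "J \<subseteq> {..<dim_col M}" "I' \<subseteq> {..<dim_row M}" "J' \<subseteq> {..<dim_col M}"
    using pos pos' by (auto simp: M_I_position_def)
  \<comment> \<open>An edge of a cycle already has two ones in the rows of that cycle, and its
    column has at most two in all, so both ends of the edge lie on the cycle.\<close>
  have ones: "{i. i < dim_row M \<and> M $$ (i, j) = 1} = {i \<in> A. M $$ (i, j) = 1}"
    if "M_I_position M A B" "j \<in> B" for A B j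
  proof (rule card_seteq[symmetric])
    show "{i \<in> A. M $$ (i, j) = 1} \<subseteq> {i. i < dim_row M \<and> M $$ (i, j) = 1}"
      using that by (auto simp: M_I_position_def)
    have "j < dim_col M"
      using that by (auto simp: M_I_position_def)
    then show "card {i. i < dim_row M \<and> M $$ (i, j) = 1} \<le> card {i \<in> A. M $$ (i, j) = 1}"
      using two M_I_position_card_col[OF that] by (simp add: two_star_mat_def)
  qed simp
  \<comment> \<open>Two different two-element sets have a union of at least three elements, so a
    common vertex at which the cycles use different edges would be the centre of a claw.\<close>
  have edges: "{j \<in> J. M $$ (v, j) = 1} = {j \<in> J'. M $$ (v, j) = 1}" (is "?E = ?E'")
    if v: "v \<in> I \<inter> I'" for v
  proof (rule ccontr)
    assume neq: "?E \<noteq> ?E'"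
    have card: "card ?E = 2" "card ?E' = 2"
      using M_I_position_card_row pos pos' v by auto
    have fin: "finite ?E" "finite ?E'"
      using card by (auto intro: card_ge_0_finite)
    have "?E \<subset> ?E \<union> ?E'"
      using neq card_seteq[OF fin(1), of ?E'] card by auto
    then have "3 \<le> card (?E \<union> ?E')"
      using psubset_card_mono[of "?E \<union> ?E'" ?E] fin card by auto
    then have "contains_mat M (transpose_mat M_3_1)"
    proof (rule three_edges_contains_claw[OF bin dist, rotated 2])
      show "card {i. i < dim_row M \<and> M $$ (i, j) = 1} = 2" if "j \<in> ?E \<union> ?E'" for j
        using that ones[OF pos] ones[OF pos'] M_I_position_card_col[OF pos]
          M_I_position_card_col[OF pos'] by auto
    qed (use v sub in auto)
    with claw show False ..
  qed
  have incident: "\<exists>i \<in> A. M $$ (i, j) = 1" if "M_I_position M A B" "j \<in> B" for A B j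
    using M_I_position_card_col[OF that] by (fastforce simp: card_2_iff)
  have rows: "I \<inter> I' = {}"
  proof (rule ccontr)
    assume meet: "I \<inter> I' \<noteq> {}"
    \<comment> \<open>The common vertices are closed under adjacency in the first cycle: by
      \<open>edges\<close>, an edge leaving such a vertex belongs to the second cycle too, and by
      \<open>ones\<close> its other end lies there as well.\<close>
    have "I \<inter> I' = I"
    proof (rule M_I_position_connected[OF pos _ meet])
      fix i i' j assume *: "i \<in> I \<inter> I'" "i' \<in> I" "j \<in> J" "M $$ (i, j) = 1" "M $$ (i', j) = 1"
      then have "j \<in> J'" using edges by blast
      then show "i' \<in> I \<inter> I'" using * ones[OF pos'] sub by blast
    qed simp
    moreover have "I \<inter> I' = I'"
    proof (rule M_I_position_connected[OF pos' _ meet])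
      fix i i' j assume *: "i \<in> I \<inter> I'" "i' \<in> I'" "j \<in> J'" "M $$ (i, j) = 1" "M $$ (i', j) = 1"
      then have "j \<in> J" using edges by blast
      then show "i' \<in> I \<inter> I'" using * ones[OF pos] sub by blast
    qed simp
    ultimately have eq: "I = I'" by simp
    \<comment> \<open>Every edge has an end in \<open>I = I'\<close>, and at that end the two cycles
      use the same edges.\<close>
    have "J = J'"
      using edges incident[OF pos] incident[OF pos'] eq by blast
    with eq ne show False by simp
  qed
  moreover have "J \<inter> J' = {}"
  proof (rule ccontr)
    assume "J \<inter> J' \<noteq> {}"
    then obtain j where j: "j \<in> J" "j \<in> J'" by blast
    then obtain i where "i \<in> I" "M $$ (i, j) = 1"
      using incident[OF pos] by blast
    \<comment> \<open>Both ends of a shared edge lie on both cycles, so a shared column forces a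
      shared row.\<close>
    then have "i \<in> I \<inter> I'"
      using ones[OF pos' j(2)] sub by blast
    with rows show False by blast
  qed
  ultimately show ?thesis ..
qed

section \<open>Transferring the result to matrices with at most two ones per row\<close>

lemma binary_mat_transpose:
  assumes "binary_mat M"
  shows "binary_mat (transpose_mat M)"
  unfolding binary_mat_def
proof
  fix a assume "a \<in> elements_mat (transpose_mat M)"
  then obtain i j where "i < dim_row M" "j < dim_col M" "a = M $$ (i, j)"
    by (auto dest: elements_matD)
  then show "a \<in> {0, 1}"
    using binary_mat_entry[OF assms] by auto
qed

lemma two_star_mat_transpose: "star_two_mat M \<Longrightarrow> two_star_mat (transpose_mat M)"
proof -
  have "{i. i < dim_row (transpose_mat M) \<and> transpose_mat M $$ (i, j) = 1} =
      {i. i < dim_col M \<and> M $$ (j, i) = 1}" if "j < dim_row M" for j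
    using that by auto
  then show "star_two_mat M \<Longrightarrow> two_star_mat (transpose_mat M)"
    by (simp add: star_two_mat_def two_star_mat_def)
qed

theorem theorem9:
  fixes M :: "nat mat" and I J I' J' :: "nat set"
  assumes "binary_mat M"
    and "two_star_mat M \<or> star_two_mat M"
    and "distinct (rows M)" and "distinct (cols M)"
    and "\<not> SC1P M"
    and "\<forall>N \<in> {M_2_1, M_2_2, M_3_1, M_3_2, M_3_3}.
           \<not> contains_mat M N \<and> \<not> contains_mat M (transpose_mat N)"
    and "M_I_position M I J" and "M_I_position M I' J'"
    and "(I, J) \<noteq> (I', J')"
  shows "I \<inter> I' = {} \<and> J \<inter> J' = {}"
  using assms(2)
proof
  assume "two_star_mat M"
  then show ?thesis
    using M_I_positions_disjoint_two_star assms by blast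
next
  assume "star_two_mat M"
  then have "two_star_mat (transpose_mat M)"
    by (rule two_star_mat_transpose)
  \<comment> \<open>A claw in the transpose of \<open>M\<close> would, transposed back, be an
    \<open>M_3_1\<close> in \<open>M\<close>, which is excluded too.\<close>
  moreover have "\<not> contains_mat (transpose_mat M) (transpose_mat M_3_1)"
    using contains_mat_transpose[of "transpose_mat M" "transpose_mat M_3_1"] assms(6) by auto
  moreover have "distinct (cols (transpose_mat M))"
    using assms(3) by simp
  ultimately have "J \<inter> J' = {} \<and> I \<inter> I' = {}"
    using M_I_positions_disjoint_two_star[OF binary_mat_transpose[OF assms(1)]] assms(9)
      M_I_position_transpose[OF assms(7)] M_I_position_transpose[OF assms(8)] by blast
  then show ?thesis by blast
qed

end
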